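(* Let $(\mathcal{X},d)$ be a data universe, let $f:\mathcal{X}\to\mathbb{R}^q$ have bounded image, let $\sigma>0$ and $\varepsilon\ge 0$, and consider the Gaussian mechanism with output distributions $P_y=N(f(y),\sigma^2 I_q)$, $y\in\mathcal{X}$, with Lebesgue densities $p_y$. Let $x,x'\in\mathcal{X}$ with $d(x,x')=1$ and let $$S^{\delta}_{x,x'}=\left\{v\in\mathbb{R}^q: \left|\log\frac{p_x(v)}{p_{x'}(v)}\right|>\varepsilon\right\}.$$ If $f(x)=f(x')$, then $S^{\delta}_{x,x'}=\emptyset$. If $f(x)\neq f(x')$, then, with $\Delta=\|f(x)-f(x')\|_2$, $\tilde u=(f(x)-f(x'))/\Delta$ and $c=\tfrac12(f(x)+f(x'))$, $$S^{\delta}_{x,x'}=\left\{v\in\mathbb{R}^q: \left|\langle v,\tilde u\rangle-\langle c,\tilde u\rangle\right|>\frac{\varepsilon\sigma^2}{\Delta}\right\}$$ and $$P_x(S^{\delta}_{x,x'})=\Phi\left(-\frac{\varepsilon\sigma}{\Delta}+\frac{\Delta}{2\sigma}\right)+\Phi\left(-\frac{\varepsilon\sigma}{\Delta}-\frac{\Delta}{2\sigma}\right).$$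
   Context: A data universe is a set $\mathcal{X}$ with the extended metric $d:\mathcal{X}\times\mathcal{X}\to[0,\infty]$ given by the shortest-path distance in an undirected graph on vertex set $\mathcal{X}$ with unit-length edges ($d=\infty$ for unconnected vertices). $\Phi$ is the standard normal cumulative distribution function; $\langle\cdot,\cdot\rangle$ and $\|\cdot\|_2$ are the Euclidean inner product and norm on $\mathbb{R}^q$. *)

theory Defs
  imports "HOL-Probability.Probability" "Graph_Theory.Pair_Digraph" "Graph_Theory.Shortest_Path"
begin

(* Undirected graphs, with arbitrary (possibly infinite) vertex set, are loop-free digraphs
   whose set of arcs is a symmetric relation.  The library's shortest-path distance is an
   infimum over walks, so it is infinite between unconnected vertices. *)
definition data_universe :: "'a set \<Rightarrow> ('a \<Rightarrow> 'a \<Rightarrow> ennreal) \<Rightarrow> bool" where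
  "data_universe X d \<longleftrightarrow>
     (\<exists>G. pair_bidirected_digraph G \<and> pverts G = X \<and>
          (\<forall>x\<in>X. \<forall>y\<in>X. enn2ereal (d x y) = wf_digraph.\<mu> (with_proj G) (\<lambda>_. 1) x y))"

(* Meaningful for positive definite covariance matrices S. *)
definition multivariate_normal_density ::
    "real ^ 'n \<Rightarrow> real ^ 'n ^ 'n \<Rightarrow> real ^ 'n \<Rightarrow> real" where
  "multivariate_normal_density m S v =
     exp (- ((v - m) \<bullet> (matrix_inv S *v (v - m))) / 2) / sqrt ((2 * pi) ^ CARD('n) * det S)"

definition multivariate_normal :: "real ^ 'n \<Rightarrow> real ^ 'n ^ 'n \<Rightarrow> (real ^ 'n) measure" where
  "multivariate_normal m S = density lborel (\<lambda>v. ennreal (multivariate_normal_density m S v))"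

(* mat (sigma^2) is the identity matrix multiplied by sigma^2. *)
definition gaussian_mechanism_density ::
    "('a \<Rightarrow> real ^ 'q) \<Rightarrow> real \<Rightarrow> 'a \<Rightarrow> real ^ 'q \<Rightarrow> real" where
  "gaussian_mechanism_density f \<sigma> y = multivariate_normal_density (f y) (mat (\<sigma>\<^sup>2))"

definition gaussian_mechanism ::
    "('a \<Rightarrow> real ^ 'q) \<Rightarrow> real \<Rightarrow> 'a \<Rightarrow> (real ^ 'q) measure" where
  "gaussian_mechanism f \<sigma> y = multivariate_normal (f y) (mat (\<sigma>\<^sup>2))"

definition privacy_violation_set ::
    "('a \<Rightarrow> 'v \<Rightarrow> real) \<Rightarrow> real \<Rightarrow> 'a \<Rightarrow> 'a \<Rightarrow> 'v set" where
  "privacy_violation_set p \<epsilon> x x' = {v. \<bar>ln (p x v / p x' v)\<bar> > \<epsilon>}"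

definition std_normal_cdf :: "real \<Rightarrow> real" where
  "std_normal_cdf = cdf std_normal_distribution"

end

(* The log-likelihood ratio of two Gaussians with common covariance sigma^2 I is the affine
   function <v - c, f(x) - f(x')> / sigma^2, so S is the complement of a slab orthogonal to u.
   The coordinates of a spherical Gaussian are independent normals, hence <v, u> is a linear
   combination of independent normals, that is N(<f(x), u>, sigma^2); the two half-spaces
   forming S contribute the two values of Phi. *)
theory Submission
  imports Defs
begin

section \<open>Scalar covariance matrices and the closed form of the density\<close>

lemma matrix_inv_mat:
  assumes "(k::real) \<noteq> 0"
  shows "matrix_inv (mat k :: real ^ 'n ^ 'n) = mat (inverse k)"
proof -
  have mat_mult: "mat a ** (mat b :: real ^ 'n ^ 'n) = mat (a * b)" for a b :: real
    by (simp add: matrix_matrix_mult_def mat_def vec_eq_iff if_distrib[where f="\<lambda>x. x * _"]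
        cong: if_cong)
  let ?A = "mat k :: real ^ 'n ^ 'n"
  have "?A ** mat (inverse k) = mat 1 \<and> mat (inverse k) ** ?A = mat 1"
    using assms by (simp add: mat_mult)
  \<comment> \<open>\<open>matrix_inv\<close> is a choice of a two-sided inverse; the witness
    \<open>mat (inverse k)\<close> shows that the chosen matrix really is one, and uniqueness of
    inverses then identifies the two.\<close>
  then have "?A ** matrix_inv ?A = mat 1 \<and> matrix_inv ?A ** ?A = mat 1"
    unfolding matrix_inv_def by (rule someI)
  then show ?thesis
    by (metis \<open>?A ** mat (inverse k) = mat 1 \<and> _\<close> matrix_mul_assoc matrix_mul_lid matrix_mul_rid)
qed

lemma mat_mult_vec: "(mat k :: real ^ 'n ^ 'n) *v v = k *\<^sub>R v"
  by (simp add: matrix_vector_mult_def mat_def vec_eq_iff if_distrib[where f="\<lambda>x. x * _"]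
      cong: if_cong)

lemma multivariate_normal_density_mat:
  fixes m v :: "real ^ 'n"
  assumes "\<sigma> > 0"
  shows "multivariate_normal_density m (mat (\<sigma>\<^sup>2)) v =
    exp (- (norm (v - m))\<^sup>2 / (2 * \<sigma>\<^sup>2)) / sqrt (2 * pi * \<sigma>\<^sup>2) ^ CARD('n)"
proof -
  have "det (mat (\<sigma>\<^sup>2) :: real ^ 'n ^ 'n) = (\<sigma>\<^sup>2) ^ CARD('n)"
    by (subst det_diagonal) (auto simp: mat_def)
  then have "sqrt ((2 * pi) ^ CARD('n) * det (mat (\<sigma>\<^sup>2) :: real ^ 'n ^ 'n)) =
      sqrt (2 * pi * \<sigma>\<^sup>2) ^ CARD('n)"
    by (metis power_mult_distrib real_sqrt_power)
  moreover have "- ((v - m) \<bullet> (matrix_inv (mat (\<sigma>\<^sup>2)) *v (v - m))) / 2 =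
      - (norm (v - m))\<^sup>2 / (2 * \<sigma>\<^sup>2)"
    using assms by (simp add: matrix_inv_mat mat_mult_vec power2_norm_eq_inner divide_simps)
  ultimately show ?thesis
    unfolding multivariate_normal_density_def by (simp only:)
qed

section \<open>Spherical Gaussians: product form, coordinates and projections\<close>

lemma prod_normal_density_Basis:
  fixes m v :: "'a::euclidean_space"
  shows "(\<Prod>b\<in>Basis. normal_density (m \<bullet> b) \<sigma> (v \<bullet> b)) =
    exp (- (norm (v - m))\<^sup>2 / (2 * \<sigma>\<^sup>2)) / sqrt (2 * pi * \<sigma>\<^sup>2) ^ DIM('a)"
proof -
  \<comment> \<open>By Pythagoras the exponent is a sum over coordinates, so the exponential
    factors.\<close>
  have "(norm (v - m))\<^sup>2 = (\<Sum>b\<in>Basis. (v \<bullet> b - m \<bullet> b)\<^sup>2)"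
    unfolding power2_norm_eq_inner
    by (subst euclidean_inner) (simp add: power2_eq_square inner_diff_left)
  then show ?thesis
    by (simp add: normal_density_def prod_dividef sum_divide_distrib
        flip: exp_sum sum_negf)
qed

text \<open>For \<sigma> > 0 the same law as \<open>gaussian_mechanism\<close>, but with the density
  written as a product over coordinates, the form to which Tonelli's theorem applies.\<close>

definition spherical_gaussian :: "'a::euclidean_space \<Rightarrow> real \<Rightarrow> 'a measure" where
  "spherical_gaussian m \<sigma> =
     density lborel (\<lambda>v. ennreal (\<Prod>b\<in>Basis. normal_density (m \<bullet> b) \<sigma> (v \<bullet> b)))"

lemma sets_spherical_gaussian [measurable_cong, simp]:
  "sets (spherical_gaussian m \<sigma>) = sets borel"
  by (simp add: spherical_gaussian_def)

lemma space_spherical_gaussian [simp]: "space (spherical_gaussian m \<sigma>) = UNIV"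
  by (simp add: spherical_gaussian_def)

lemma gaussian_mechanism_eq_spherical_gaussian:
  "\<sigma> > 0 \<Longrightarrow> gaussian_mechanism f \<sigma> x = spherical_gaussian (f x) \<sigma>"
  by (simp add: gaussian_mechanism_def multivariate_normal_def spherical_gaussian_def
      multivariate_normal_density_mat prod_normal_density_Basis)

text \<open>Tonelli: on a box the indicator factors over the coordinates just as the density does.
  Total mass, marginals and independence of the coordinates are all read off from this
  identity.\<close>

lemma emeasure_spherical_gaussian_PiE:
  fixes m :: "'a::euclidean_space"
  assumes A: "\<And>b. b \<in> Basis \<Longrightarrow> A b \<in> sets borel"
  shows "emeasure (spherical_gaussian m \<sigma>) {v. \<forall>b\<in>Basis. v \<bullet> b \<in> A b} =
    (\<Prod>b\<in>Basis. emeasure (density lborel (normal_density (m \<bullet> b) \<sigma>)) (A b))"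
proof -
  have [measurable]: "{v::'a. \<forall>b\<in>Basis. v \<bullet> b \<in> A b} \<in> sets borel"
  proof -
    have "{v::'a. \<forall>b\<in>Basis. v \<bullet> b \<in> A b} = (\<Inter>b\<in>Basis. (\<lambda>v. v \<bullet> b) -` A b \<inter> space borel)"
      by auto
    also have "\<dots> \<in> sets borel"
      using A by (intro sets.finite_INT measurable_sets[where A = borel]) auto
    finally show ?thesis .
  qed
  have "emeasure (spherical_gaussian m \<sigma>) {v. \<forall>b\<in>Basis. v \<bullet> b \<in> A b} =
      (\<integral>\<^sup>+v. ennreal (\<Prod>b\<in>Basis. normal_density (m \<bullet> b) \<sigma> (v \<bullet> b)) *
        indicator {v. \<forall>b\<in>Basis. v \<bullet> b \<in> A b} v \<partial>lborel)"
    unfolding spherical_gaussian_def by (subst emeasure_density) auto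
  also have "\<dots> = (\<integral>\<^sup>+v. (\<Prod>b\<in>Basis.
      ennreal (normal_density (m \<bullet> b) \<sigma> (v \<bullet> b)) * indicator (A b) (v \<bullet> b)) \<partial>lborel)"
  proof (intro nn_integral_cong)
    fix v :: 'a
    have "indicator {v. \<forall>b\<in>Basis. v \<bullet> b \<in> A b} v =
        (\<Prod>b\<in>Basis. indicator (A b) (v \<bullet> b) :: ennreal)"
      by (auto simp: indicator_def prod.neutral)
    then show "ennreal (\<Prod>b\<in>Basis. normal_density (m \<bullet> b) \<sigma> (v \<bullet> b)) *
        indicator {v. \<forall>b\<in>Basis. v \<bullet> b \<in> A b} v =
        (\<Prod>b\<in>Basis. ennreal (normal_density (m \<bullet> b) \<sigma> (v \<bullet> b)) * indicator (A b) (v \<bullet> b))"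
      by (simp add: prod.distrib prod_ennreal)
  qed
  also have "\<dots> = (\<Prod>b\<in>Basis.
      \<integral>\<^sup>+t. ennreal (normal_density (m \<bullet> b) \<sigma> t) * indicator (A b) t \<partial>lborel)"
    using A by (intro nn_integral_lborel_prod) auto
  also have "\<dots> = (\<Prod>b\<in>Basis. emeasure (density lborel (normal_density (m \<bullet> b) \<sigma>)) (A b))"
    using A by (intro prod.cong refl) (simp add: emeasure_density)
  finally show ?thesis .
qed

lemma emeasure_normal_density_UNIV:
  "\<sigma> > 0 \<Longrightarrow> emeasure (density lborel (normal_density \<mu> \<sigma>)) UNIV = 1"
  using prob_space.emeasure_space_1[OF prob_space_normal_density] by simp

lemma prob_space_spherical_gaussian: "\<sigma> > 0 \<Longrightarrow> prob_space (spherical_gaussian m \<sigma>)"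
  using emeasure_spherical_gaussian_PiE[of "\<lambda>_. UNIV" m \<sigma>]
  by (intro prob_spaceI) (simp add: emeasure_normal_density_UNIV)

lemma distributed_spherical_gaussian_Basis:
  fixes m :: "'a::euclidean_space"
  assumes "\<sigma> > 0" "b \<in> Basis"
  shows "distributed (spherical_gaussian m \<sigma>) lborel (\<lambda>v. v \<bullet> b) (normal_density (m \<bullet> b) \<sigma>)"
proof -
  have "distr (spherical_gaussian m \<sigma>) lborel (\<lambda>v. v \<bullet> b) =
      density lborel (normal_density (m \<bullet> b) \<sigma>)"
  proof (rule measure_eqI)
    fix A assume "A \<in> sets (distr (spherical_gaussian m \<sigma>) lborel (\<lambda>v. v \<bullet> b))"
    then have A: "A \<in> sets borel" by simp
    \<comment> \<open>The box that constrains only coordinate \<open>b\<close>; every other factor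
      is the total mass 1 of a normal law.\<close>
    let ?A = "\<lambda>i. if i = b then A else UNIV"
    have "emeasure (distr (spherical_gaussian m \<sigma>) lborel (\<lambda>v. v \<bullet> b)) A =
        emeasure (spherical_gaussian m \<sigma>) {v. \<forall>i\<in>Basis. v \<bullet> i \<in> ?A i}"
      using assms A by (subst emeasure_distr) (auto intro!: arg_cong[where f = "emeasure _"])
    also have "\<dots> = (\<Prod>i\<in>Basis. emeasure (density lborel (normal_density (m \<bullet> i) \<sigma>)) (?A i))"
      using A by (intro emeasure_spherical_gaussian_PiE) auto
    also have "\<dots> = emeasure (density lborel (normal_density (m \<bullet> b) \<sigma>)) A *
        (\<Prod>i\<in>Basis - {b}. emeasure (density lborel (normal_density (m \<bullet> i) \<sigma>)) (?A i))"
      using assms by (subst prod.remove[of _ b]) auto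
    also have "(\<Prod>i\<in>Basis - {b}. emeasure (density lborel (normal_density (m \<bullet> i) \<sigma>)) (?A i)) = 1"
      using assms by (intro prod.neutral) (auto simp: emeasure_normal_density_UNIV)
    finally show "emeasure (distr (spherical_gaussian m \<sigma>) lborel (\<lambda>v. v \<bullet> b)) A =
        emeasure (density lborel (normal_density (m \<bullet> b) \<sigma>)) A" by simp
  qed simp
  then show ?thesis
    by (simp add: distributed_def)
qed

text \<open>Box probabilities factor, and by the marginal laws each factor is the probability of the
  corresponding coordinate event.\<close>

lemma indep_vars_spherical_gaussian_Basis:
  fixes m :: "'a::euclidean_space"
  assumes "\<sigma> > 0"
  shows "prob_space.indep_vars (spherical_gaussian m \<sigma>) (\<lambda>_. borel) (\<lambda>b v. v \<bullet> b) Basis"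
proof -
  interpret prob_space "spherical_gaussian m \<sigma>"
    using assms by (rule prob_space_spherical_gaussian)
  have "prob (\<Inter>b\<in>Basis. (\<lambda>v. v \<bullet> b) -` A b \<inter> space (spherical_gaussian m \<sigma>)) =
      (\<Prod>b\<in>Basis. prob ((\<lambda>v. v \<bullet> b) -` A b \<inter> space (spherical_gaussian m \<sigma>)))"
    if "A \<in> Basis \<rightarrow> sets borel" for A
  proof -
    have A: "A b \<in> sets borel" if "b \<in> Basis" for b
      using \<open>A \<in> _\<close> that by auto
    have eq: "(\<Inter>b\<in>Basis. (\<lambda>v. v \<bullet> b) -` A b \<inter> space (spherical_gaussian m \<sigma>)) =
        {v::'a. \<forall>b\<in>Basis. v \<bullet> b \<in> A b}"
      by auto
    have marginal: "emeasure (density lborel (normal_density (m \<bullet> b) \<sigma>)) (A b) =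
        ennreal (prob ((\<lambda>v. v \<bullet> b) -` A b \<inter> space (spherical_gaussian m \<sigma>)))"
      if "b \<in> Basis" for b
    proof -
      have "emeasure (density lborel (normal_density (m \<bullet> b) \<sigma>)) (A b) =
          emeasure (distr (spherical_gaussian m \<sigma>) lborel (\<lambda>v. v \<bullet> b)) (A b)"
        using distributed_spherical_gaussian_Basis[OF assms that, of m]
        by (simp add: distributed_def)
      also have "\<dots> = emeasure (spherical_gaussian m \<sigma>)
          ((\<lambda>v. v \<bullet> b) -` A b \<inter> space (spherical_gaussian m \<sigma>))"
        using A[OF that] by (subst emeasure_distr) auto
      finally show ?thesis by (simp add: emeasure_eq_measure)
    qed
    have "ennreal (prob {v::'a. \<forall>b\<in>Basis. v \<bullet> b \<in> A b}) =
        (\<Prod>b\<in>Basis. ennreal (prob ((\<lambda>v. v \<bullet> b) -` A b \<inter> space (spherical_gaussian m \<sigma>))))"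
      unfolding emeasure_eq_measure [symmetric]
      using emeasure_spherical_gaussian_PiE[of A m \<sigma>, OF A] marginal
      by (simp add: emeasure_eq_measure)
    also have "\<dots> =
        ennreal (\<Prod>b\<in>Basis. prob ((\<lambda>v. v \<bullet> b) -` A b \<inter> space (spherical_gaussian m \<sigma>)))"
      by (rule prod_ennreal) simp
    finally show ?thesis
      unfolding eq by (subst (asm) ennreal_inj) (auto intro!: prod_nonneg)
  qed
  \<comment> \<open>The generators are all Borel sets, which include the whole line; hence product
    formulas over the full basis also cover its subfamilies.\<close>
  then show ?thesis
    by (subst indep_vars_finite[where E = "\<lambda>_. sets borel"])
      (auto simp: Int_stable_def sets.sigma_sets_eq[of borel, simplified])
qed

text \<open>Independent normals add in mean and variance; as \<open>u\<close> is a unit vector, the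
  coordinate variances, weighted by the squared coefficients, sum to \<sigma>^2 again.\<close>

lemma distributed_spherical_gaussian_inner:
  fixes m u :: "'a::euclidean_space"
  assumes "\<sigma> > 0" "norm u = 1"
  shows "distributed (spherical_gaussian m \<sigma>) lborel (\<lambda>v. v \<bullet> u) (normal_density (m \<bullet> u) \<sigma>)"
proof -
  interpret prob_space "spherical_gaussian m \<sigma>"
    using assms(1) by (rule prob_space_spherical_gaussian)
  \<comment> \<open>Zero coefficients would give degenerate summands, which have no density.\<close>
  define I where "I = {b\<in>Basis. u \<bullet> b \<noteq> 0}"
  have I: "finite I" "I \<subseteq> Basis"
    by (auto simp: I_def)
  have inner_I: "v \<bullet> u = (\<Sum>b\<in>I. (u \<bullet> b) * (v \<bullet> b))" for v
    unfolding I_def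
    by (subst euclidean_inner, rule sum.mono_neutral_cong_right) (auto simp: mult.commute)
  \<comment> \<open>An empty sum would give \<open>u \<bullet> u = 0\<close>. The rule for sums of
    independent normals requires a nonempty index set.\<close>
  have "I \<noteq> {}"
    using inner_I[of u] assms(2) by (auto simp: norm_eq_sqrt_inner)
  have "distributed (spherical_gaussian m \<sigma>) lborel (\<lambda>v. \<Sum>b\<in>I. (u \<bullet> b) * (v \<bullet> b))
      (normal_density (\<Sum>b\<in>I. (u \<bullet> b) * (m \<bullet> b)) (sqrt (\<Sum>b\<in>I. (\<bar>u \<bullet> b\<bar> * \<sigma>)\<^sup>2)))"
  proof (rule sum_indep_normal)
    show "indep_vars (\<lambda>_. borel) (\<lambda>b v. (u \<bullet> b) * (v \<bullet> b)) I"
      using indep_vars_compose2[OF indep_vars_subset[OF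
          indep_vars_spherical_gaussian_Basis[OF assms(1)] I(2)],
          of "\<lambda>b t. (u \<bullet> b) * t" "\<lambda>_. borel"] by simp
    \<comment> \<open>The absolute value keeps the standard deviation positive when the coefficient
      is negative.\<close>
    show "distributed (spherical_gaussian m \<sigma>) lborel (\<lambda>v. (u \<bullet> b) * (v \<bullet> b))
        (normal_density ((u \<bullet> b) * (m \<bullet> b)) (\<bar>u \<bullet> b\<bar> * \<sigma>))" if "b \<in> I" for b
      using normal_density_affine[OF distributed_spherical_gaussian_Basis[of \<sigma> b m], of "u \<bullet> b" 0]
        that assms(1) by (auto simp: I_def)
  qed (use assms I \<open>I \<noteq> {}\<close> in \<open>auto simp: I_def\<close>)
  \<comment> \<open>This is \<open>inner_I\<close> at \<open>v = u\<close>, scaled by the common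
    variance.\<close>
  also have "(\<Sum>b\<in>I. (\<bar>u \<bullet> b\<bar> * \<sigma>)\<^sup>2) = (u \<bullet> u) * \<sigma>\<^sup>2"
    by (subst inner_I) (simp add: power_mult_distrib sum_distrib_right flip: power2_eq_square)
  also have "sqrt \<dots> = \<sigma>"
    using assms by (simp add: norm_eq_1)
  finally show ?thesis
    by (simp only: inner_I [symmetric])
qed

section \<open>Normal tails in terms of the standard normal distribution function\<close>

context prob_space
begin

lemma prob_normal_less:
  assumes X: "distributed M lborel X (normal_density \<mu> \<sigma>)" and \<sigma>: "\<sigma> > 0"
  shows "prob {\<omega> \<in> space M. X \<omega> < a} = std_normal_cdf ((a - \<mu>) / \<sigma>)"
proof -
  \<comment> \<open>Standardisation reduces the claim to the standard normal law.\<close>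
  let ?Z = "\<lambda>\<omega>. (X \<omega> - \<mu>) / \<sigma>"
  have Z: "distributed M lborel ?Z std_normal_density"
    using X by (rule normal_standard_normal_convert[OF \<sigma>, THEN iffD1])
  then have [measurable]: "?Z \<in> borel_measurable M"
    by (simp add: distributed_def)
  have "prob {\<omega> \<in> space M. X \<omega> < a} = prob (?Z -` {..<(a - \<mu>) / \<sigma>} \<inter> space M)"
    using \<sigma> by (intro arg_cong[where f = prob]) (auto simp: divide_simps)
  also have "\<dots> = measure (distr M lborel ?Z) {..<(a - \<mu>) / \<sigma>}"
    by (subst measure_distr) auto
  also have "distr M lborel ?Z = std_normal_distribution"
    using Z by (simp add: distributed_def)
  \<comment> \<open>\<open>cdf\<close> measures the closed half-line, whereas the event is strict;
    the endpoint is a Lebesgue null set.\<close>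
  also have "measure std_normal_distribution {..<(a - \<mu>) / \<sigma>} =
      measure std_normal_distribution {..(a - \<mu>) / \<sigma>}"
  proof (rule measure_eq_AE)
    have "AE t in lborel. t \<noteq> (a - \<mu>) / \<sigma>"
      by (rule AE_lborel_singleton)
    then show "AE t in std_normal_distribution.
        t \<in> {..<(a - \<mu>) / \<sigma>} \<longleftrightarrow> t \<in> {..(a - \<mu>) / \<sigma>}"
      by (subst AE_density) auto
  qed auto
  finally show ?thesis
    by (simp add: std_normal_cdf_def cdf_def)
qed

text \<open>Reflection: \<open>X > a\<close> means \<open>- X < - a\<close>, and \<open>- X\<close>
  is normal with mean \<open>- \<mu>\<close> and the same deviation.\<close>

lemma prob_normal_greater:
  assumes X: "distributed M lborel X (normal_density \<mu> \<sigma>)" and \<sigma>: "\<sigma> > 0"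
  shows "prob {\<omega> \<in> space M. X \<omega> > a} = std_normal_cdf ((\<mu> - a) / \<sigma>)"
proof -
  have "distributed M lborel (\<lambda>\<omega>. - X \<omega>) (normal_density (- \<mu>) \<sigma>)"
    using normal_density_affine[OF X \<sigma>, of "- 1" 0] by simp
  from prob_normal_less[OF this \<sigma>, of "- a"] show ?thesis
    by simp
qed

end

section \<open>The log-likelihood ratio, the violation set and its probability\<close>

lemma ln_gaussian_density_ratio:
  fixes f :: "'a \<Rightarrow> real ^ 'q"
  assumes "\<sigma> > 0"
  shows "ln (gaussian_mechanism_density f \<sigma> x v / gaussian_mechanism_density f \<sigma> x' v) =
    (v - (1/2) *\<^sub>R (f x + f x')) \<bullet> (f x - f x') / \<sigma>\<^sup>2"
proof -
  \<comment> \<open>The normalising constants agree because the covariance is common, so they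
    cancel.\<close>
  have "gaussian_mechanism_density f \<sigma> x v / gaussian_mechanism_density f \<sigma> x' v =
      exp (- (norm (v - f x))\<^sup>2 / (2 * \<sigma>\<^sup>2) - - (norm (v - f x'))\<^sup>2 / (2 * \<sigma>\<^sup>2))"
    using assms by (simp add: gaussian_mechanism_density_def multivariate_normal_density_mat
        flip: exp_diff)
  then have "ln (gaussian_mechanism_density f \<sigma> x v / gaussian_mechanism_density f \<sigma> x' v) =
      ((norm (v - f x'))\<^sup>2 - (norm (v - f x))\<^sup>2) / (2 * \<sigma>\<^sup>2)"
    by (simp add: diff_divide_distrib)
  \<comment> \<open>Difference of squares: with \<open>a = v - f x'\<close> and
    \<open>b = v - f x\<close>, the vector \<open>a - b\<close> is \<open>f x - f x'\<close> and
    \<open>a + b\<close> is twice the offset of \<open>v\<close> from the midpoint. The terms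
    quadratic in \<open>v\<close> cancel, which makes the ratio affine.\<close>
  also have "(norm (v - f x'))\<^sup>2 - (norm (v - f x))\<^sup>2 =
      2 * ((v - (1/2) *\<^sub>R (f x + f x')) \<bullet> (f x - f x'))"
    by (simp add: power2_norm_eq_inner inner_simps inner_commute algebra_simps)
  finally show ?thesis by simp
qed

theorem mainTheorem4:
  fixes X :: "'a set" and d :: "'a \<Rightarrow> 'a \<Rightarrow> ennreal"
    and f :: "'a \<Rightarrow> real ^ 'q"
    and \<sigma> \<epsilon> :: real and x x' :: 'a
  assumes "data_universe X d"
    and "bounded (f ` X)"
    and "\<sigma> > 0" and "\<epsilon> \<ge> 0"
    and "x \<in> X" and "x' \<in> X" and "d x x' = 1"
  shows "let S = privacy_violation_set (gaussian_mechanism_density f \<sigma>) \<epsilon> x x' in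
    (f x = f x' \<longrightarrow> S = {}) \<and>
    (f x \<noteq> f x' \<longrightarrow>
      (let \<Delta> = norm (f x - f x');
           u = (f x - f x') /\<^sub>R \<Delta>;
           c = (1/2) *\<^sub>R (f x + f x')
       in S = {v. \<bar>v \<bullet> u - c \<bullet> u\<bar> > \<epsilon> * \<sigma>\<^sup>2 / \<Delta>} \<and>
          measure (gaussian_mechanism f \<sigma> x) S =
            std_normal_cdf (- (\<epsilon> * \<sigma> / \<Delta>) + \<Delta> / (2 * \<sigma>)) +
            std_normal_cdf (- (\<epsilon> * \<sigma> / \<Delta>) - \<Delta> / (2 * \<sigma>))))"
proof -
  define S where "S = privacy_violation_set (gaussian_mechanism_density f \<sigma>) \<epsilon> x x'"
  define \<Delta> where "\<Delta> = norm (f x - f x')"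
  define u where "u = (f x - f x') /\<^sub>R \<Delta>"
  define c where "c = (1/2) *\<^sub>R (f x + f x')"
  have S_eq: "S = {v. \<bar>(v - c) \<bullet> (f x - f x') / \<sigma>\<^sup>2\<bar> > \<epsilon>}"
    using assms by (simp add: S_def c_def privacy_violation_set_def ln_gaussian_density_ratio)
  \<comment> \<open>The inner product vanishes, so membership would mean
    \<open>0 > \<epsilon>\<close>.\<close>
  have "S = {}" if "f x = f x'"
    using assms that by (simp add: S_eq)
  moreover have "S = {v. \<bar>v \<bullet> u - c \<bullet> u\<bar> > \<epsilon> * \<sigma>\<^sup>2 / \<Delta>} \<and>
      measure (gaussian_mechanism f \<sigma> x) S =
        std_normal_cdf (- (\<epsilon> * \<sigma> / \<Delta>) + \<Delta> / (2 * \<sigma>)) +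
        std_normal_cdf (- (\<epsilon> * \<sigma> / \<Delta>) - \<Delta> / (2 * \<sigma>))" if "f x \<noteq> f x'"
  proof -
    have \<Delta>: "\<Delta> > 0" and u: "norm u = 1" and diff: "f x - f x' = \<Delta> *\<^sub>R u"
      using that by (simp_all add: \<Delta>_def u_def)
    \<comment> \<open>Substitute \<open>diff\<close> and multiply the inequality by the positive
      number \<sigma>^2 / \<Delta>.\<close>
    have slab: "S = {v. \<bar>v \<bullet> u - c \<bullet> u\<bar> > \<epsilon> * \<sigma>\<^sup>2 / \<Delta>}"
      using \<Delta> assms(3)
      by (auto simp: S_eq diff inner_diff_left abs_mult divide_simps mult.commute)
    \<comment> \<open>The half-width of the slab.\<close>
    define r where "r = \<epsilon> * \<sigma>\<^sup>2 / \<Delta>"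
    have r: "r \<ge> 0"
      using \<Delta> assms by (simp add: r_def)
    \<comment> \<open>Along \<open>u\<close> the mean \<open>f x\<close> lies half the distance
      \<Delta> beyond the midpoint \<open>c\<close>; this shift produces the terms \<Delta> / (2
      \<sigma>).\<close>
    have "f x \<bullet> u - c \<bullet> u = (1/2) * ((f x - f x') \<bullet> u)"
      by (simp add: c_def inner_simps algebra_simps)
    also have "\<dots> = \<Delta> / 2"
      using u by (simp add: diff norm_eq_1)
    finally have mean: "f x \<bullet> u = c \<bullet> u + \<Delta> / 2" by simp
    let ?N = "spherical_gaussian (f x) \<sigma>"
    interpret prob_space ?N
      using assms(3) by (rule prob_space_spherical_gaussian)
    have X: "distributed ?N lborel (\<lambda>v. v \<bullet> u) (normal_density (f x \<bullet> u) \<sigma>)"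
      using assms(3) u by (rule distributed_spherical_gaussian_inner)
    have "S = {v \<in> space ?N. v \<bullet> u > c \<bullet> u + r} \<union> {v \<in> space ?N. v \<bullet> u < c \<bullet> u - r}"
      using r by (auto simp: slab r_def [symmetric])
    \<comment> \<open>The two open half-spaces are disjoint because \<open>r \<ge> 0\<close>, so
      their probabilities add.\<close>
    then have "prob S = prob {v \<in> space ?N. v \<bullet> u > c \<bullet> u + r} +
        prob {v \<in> space ?N. v \<bullet> u < c \<bullet> u - r}"
      using r by (simp only:) (rule finite_measure_Union, auto)
    also have "\<dots> = std_normal_cdf ((f x \<bullet> u - (c \<bullet> u + r)) / \<sigma>) +
        std_normal_cdf ((c \<bullet> u - r - f x \<bullet> u) / \<sigma>)"
      by (simp only: prob_normal_greater[OF X assms(3)] prob_normal_less[OF X assms(3)])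
    \<comment> \<open>Here \<open>r / \<sigma>\<close> equals \<epsilon> \<sigma> / \<Delta>. The
      upper half-space is on the side of \<open>f x\<close> and gains the shift; the lower one loses
      it.\<close>
    also have "(f x \<bullet> u - (c \<bullet> u + r)) / \<sigma> = - (\<epsilon> * \<sigma> / \<Delta>) + \<Delta> / (2 * \<sigma>)"
      using assms(3) \<Delta> by (simp add: mean r_def field_simps power2_eq_square)
    also have "(c \<bullet> u - r - f x \<bullet> u) / \<sigma> = - (\<epsilon> * \<sigma> / \<Delta>) - \<Delta> / (2 * \<sigma>)"
      using assms(3) \<Delta> by (simp add: mean r_def field_simps power2_eq_square)
    finally show ?thesis
      using slab by (simp add: gaussian_mechanism_eq_spherical_gaussian assms(3))
  qed
  ultimately show ?thesis
    unfolding S_def \<Delta>_def u_def c_def Let_def by blast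
qed

end
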